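(* For every positive integer $N$, \begin{equation*} F_N(a,b;t) = \frac{(1-b)(1-tq^{N+1})}{(1-t)(1-bq^{N+1})}+ \frac{(1-q^{N+1})(b-atq)}{(1-bq^{N+1})(1-t)}F_N(a,b;tq). \end{equation*}
   Context: Let $|q|<1$ and use the $q$-Pochhammer notation $(A)_0=(A;q)_0=1$, $(A)_n=(A;q)_n=(1-A)(1-Aq)\cdots(1-Aq^{n-1})$ for $n\ge 1$, and the Gaussian binomial coefficient $\begin{bmatrix} N\\ n\end{bmatrix}=\frac{(q)_N}{(q)_n(q)_{N-n}}$. For $N\in\mathbb{N}$ the finite analogue of Fine's function is defined by \begin{equation*} F_{N}(a,b;t):=\sum_{n=0}^{N}\begin{bmatrix} N\\ n\end{bmatrix}\frac{(a q)_{n}(t)_{N-n}(q)_n t^{n}}{(b q)_{n}(t)_N }. \end{equation*} Parameters $a,b,t$ are such that all denominators are nonzero.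
   Formalization: The left-hand side is F_{N+1}(a,b;t) instead of F_N(a,b;t); with F_N the identity is false, e.g. for N=1, a=b=0, q=t=1/2 the left side is 3/2 and the right side 7/4. *)

theory Defs
  imports Complex_Main
begin

definition qpoch :: "complex \<Rightarrow> complex \<Rightarrow> nat \<Rightarrow> complex" where
  "qpoch A q n = (\<Prod>i<n. 1 - A * q ^ i)"

text \<open>The denominator is nonzero whenever \<open>n \<le> N\<close> and \<open>norm q < 1\<close>; the definition is only
  used in that range.\<close>

definition gauss_binomial :: "complex \<Rightarrow> nat \<Rightarrow> nat \<Rightarrow> complex" where
  "gauss_binomial q N n = qpoch q q N / (qpoch q q n * qpoch q q (N - n))"

definition fine :: "complex \<Rightarrow> nat \<Rightarrow> complex \<Rightarrow> complex \<Rightarrow> complex \<Rightarrow> complex" where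
  "fine q N a b t =
     (\<Sum>n=0..N. gauss_binomial q N n *
        (qpoch (a * q) q n * qpoch t q (N - n) * qpoch q q n * t ^ n /
         (qpoch (b * q) q n * qpoch t q N)))"

text \<open>In the functional equation for \<open>t \<mapsto> t q\<close> with coefficients in \<open>q ^ (N + 1)\<close>, the left-hand
  side must be the function of index \<open>N + 1\<close>, not \<open>N\<close>: with equal indices the equation already
  fails for \<open>N = 1\<close>, \<open>a = b = 0\<close>, \<open>q = t = 1/2\<close> (left-hand side \<open>3/2\<close>, right-hand side \<open>7/4\<close>).\<close>

lemma fine_same_index_counterexample:
  "\<exists>q a b t :: complex. \<exists>N > 0. norm q < 1 \<and>
     qpoch t q (N + 1) \<noteq> 0 \<and> qpoch (b * q) q (N + 1) \<noteq> 0 \<and>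
     fine q N a b t \<noteq>
       (1 - b) * (1 - t * q ^ (N + 1)) / ((1 - t) * (1 - b * q ^ (N + 1))) +
       (1 - q ^ (N + 1)) * (b - a * t * q) / ((1 - b * q ^ (N + 1)) * (1 - t)) *
         fine q N a b (t * q)"
  apply (rule exI[of _ "1/2"], rule exI[of _ 0], rule exI[of _ 0],
        rule exI[of _ "1/2"], rule exI[of _ 1])
  apply (simp add: fine_def gauss_binomial_def qpoch_def power2_eq_square norm_divide)
  done

end

theory Submission
  imports Defs
begin

text \<open>Write \<open>F\<^sub>M(a,b;t)\<close> as a sum of terms \<open>T n\<close>. With \<open>M = N + 1\<close> the \<open>n\<close>-th term of
  \<open>(1 - q^M) F\<^sub>N(a,b;tq)\<close> is \<open>(q^n - q^M) T n\<close>, so the functional equation is the evaluation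
  \<open>\<Sum>n\<le>M. ((1 - b q^M)(1 - t) - (b - a t q)(q^n - q^M)) T n = (1 - b)(1 - t q^M)\<close>. This sum
  telescopes: its summand is \<open>G n - G (n + 1)\<close> for \<open>G n = (1 - b q^n)(1 - t q^(M-n)) T n\<close>.\<close>

lemma qpoch_0 [simp]: "qpoch A q 0 = 1"
  by (simp add: qpoch_def)

lemma qpoch_Suc: "qpoch A q (Suc n) = qpoch A q n * (1 - A * q ^ n)"
  by (simp add: qpoch_def)

lemma qpoch_Suc_shift: "qpoch A q (Suc n) = (1 - A) * qpoch (A * q) q n"
  by (simp add: qpoch_def prod.lessThan_Suc_shift mult.assoc del: prod.lessThan_Suc)

lemma qpoch_neq_0_mono:
  assumes "qpoch A q N \<noteq> 0" "n \<le> N"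
  shows "qpoch A q n \<noteq> 0"
  using assms by (auto simp: qpoch_def)

lemma qpoch_neq_0_factor:
  assumes "qpoch A q N \<noteq> 0" "n < N"
  shows "1 - A * q ^ n \<noteq> 0"
  using assms by (auto simp: qpoch_def)

text \<open>A vanishing factor would give \<open>norm q ^ (i + 1) = 1\<close>, impossible inside the
  unit disc.\<close>

lemma qpoch_self_neq_0:
  assumes "norm q < 1"
  shows "qpoch q q n \<noteq> 0"
proof -
  have "q * q ^ i \<noteq> 1" for i
  proof
    assume "q * q ^ i = 1"
    then have "norm q ^ Suc i = 1"
      by (metis norm_one norm_power power_Suc)
    moreover have "norm q ^ Suc i < 1"
      using assms by (simp add: power_less_one_iff del: power_Suc)
    ultimately show False by simp
  qed
  then show ?thesis by (simp add: qpoch_def)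
qed

text \<open>The summand of \<open>fine\<close> after \<open>qpoch q q n\<close> has been cancelled
  against the Gaussian binomial.\<close>

definition fine_term :: "complex \<Rightarrow> nat \<Rightarrow> complex \<Rightarrow> complex \<Rightarrow> complex \<Rightarrow> nat \<Rightarrow> complex" where
  "fine_term q M a b t n =
     qpoch q q M * qpoch (a * q) q n * qpoch t q (M - n) * t ^ n /
     (qpoch q q (M - n) * qpoch (b * q) q n * qpoch t q M)"

lemma fine_eq_sum_fine_term:
  assumes "norm q < 1"
  shows "fine q M a b t = (\<Sum>n\<le>M. fine_term q M a b t n)"
  unfolding fine_def fine_term_def gauss_binomial_def atLeast0AtMost
  using qpoch_self_neq_0[OF assms] by (intro sum.cong refl) (simp add: mult.assoc)

lemma fine_term_0:
  assumes "norm q < 1" "qpoch t q M \<noteq> 0"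
  shows "fine_term q M a b t 0 = 1"
  using assms qpoch_self_neq_0 by (simp add: fine_term_def)

text \<open>The ratio of consecutive terms, cleared of denominators so that the left side is exactly
  the telescoping function \<open>G\<close> at \<open>n + 1\<close>.\<close>

lemma fine_term_Suc:
  assumes "norm q < 1" "qpoch t q M \<noteq> 0" "qpoch (b * q) q M \<noteq> 0" "n < M"
  shows "fine_term q M a b t (Suc n) * (1 - b * q ^ Suc n) * (1 - t * q ^ (M - Suc n)) =
         fine_term q M a b t n * t * (1 - a * q ^ Suc n) * (1 - q ^ (M - n))"
proof -
  \<comment> \<open>Naming \<open>d = M - n - 1\<close> removes the truncated subtraction, so the
    factors at \<open>M - n\<close> split by \<open>qpoch_Suc\<close>.\<close>
  obtain d where d: "M - n = Suc d" "M - Suc n = d"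
    using \<open>n < M\<close> by (metis Suc_diff_Suc)
  have "qpoch (b * q) q n \<noteq> 0" "1 - b * q ^ Suc n \<noteq> 0" "1 - t * q ^ d \<noteq> 0"
    using assms qpoch_neq_0_mono[of "b * q" q M n] qpoch_neq_0_factor[of "b * q" q M n]
      qpoch_neq_0_factor[of t q M d] d
    by (auto simp: mult.assoc)
  moreover have "qpoch q q d \<noteq> 0" "1 - q ^ Suc d \<noteq> 0"
    using qpoch_self_neq_0[OF assms(1), of "Suc d"] by (auto simp: qpoch_Suc)
  moreover have "qpoch (c * q) q (Suc n) = qpoch (c * q) q n * (1 - c * q ^ Suc n)" for c
    by (simp add: qpoch_Suc mult.assoc)
  moreover have "qpoch q q (Suc d) = qpoch q q d * (1 - q ^ Suc d)"
    by (simp add: qpoch_Suc)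
  ultimately show ?thesis
    using assms(2) unfolding fine_term_def d qpoch_Suc[of t]
    by (simp add: divide_simps del: power_Suc) simp
qed

text \<open>Since \<open>qpoch t q (k + 1) = (1 - t) * qpoch (t * q) q k\<close>, the quotient of
  the \<open>t\<close>-symbols is the same on both sides. The power \<open>(t * q) ^ n\<close>
  contributes \<open>q ^ n\<close>, and raising \<open>N\<close> by one in the
  \<open>q\<close>-symbols costs \<open>(1 - q ^ (N + 1)) / (1 - q ^ (N + 1 - n))\<close>.\<close>

lemma fine_term_shift:
  assumes "norm q < 1" "qpoch t q (Suc N) \<noteq> 0" "n \<le> N"
  shows "(1 - q ^ Suc N) * fine_term q N a b (t * q) n =
         (q ^ n - q ^ Suc N) * fine_term q (Suc N) a b t n"
proof -
  have d: "Suc N - n = Suc (N - n)"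
    using assms(3) by simp
  have "q ^ n - q ^ Suc N = q ^ n * (1 - q ^ Suc (N - n))"
    using assms(3) by (simp add: algebra_simps flip: power_add)
  moreover have "1 - t \<noteq> 0" "qpoch (t * q) q N \<noteq> 0"
    using assms(2) by (auto simp: qpoch_Suc_shift)
  moreover have "qpoch q q (N - n) \<noteq> 0" "1 - q ^ Suc (N - n) \<noteq> 0"
    using qpoch_self_neq_0[OF assms(1), of "Suc (N - n)"] by (auto simp: qpoch_Suc)
  moreover have "qpoch q q (Suc k) = qpoch q q k * (1 - q ^ Suc k)" for k
    by (simp add: qpoch_Suc)
  ultimately show ?thesis
    unfolding fine_term_def d qpoch_Suc_shift[of t]
    by (simp add: divide_simps power_mult_distrib del: power_Suc)
qed

lemma sum_fine_term_weighted:
  assumes "norm q < 1" "qpoch t q M \<noteq> 0" "qpoch (b * q) q M \<noteq> 0"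
  shows "(\<Sum>n\<le>M. ((1 - b * q ^ M) * (1 - t) - (b - a * t * q) * (q ^ n - q ^ M)) *
            fine_term q M a b t n) = (1 - b) * (1 - t * q ^ M)"
proof -
  define T where "T = fine_term q M a b t"
  define w where "w n = (1 - b * q ^ M) * (1 - t) - (b - a * t * q) * (q ^ n - q ^ M)" for n
  define G where "G n = T n * (1 - b * q ^ n) * (1 - t * q ^ (M - n))" for n
  have "w n * T n = G n - G (Suc n)" if "n < M" for n
  proof -
    \<comment> \<open>With \<open>x = q ^ n\<close> and \<open>y = q ^ (M - n)\<close>, so
      \<open>x * y = q ^ M\<close>, the weight becomes
      \<open>(1 - b x)(1 - t y) - t (1 - a q x)(1 - y)\<close>: the two products are the factors in
      \<open>G n\<close> and in the right side of \<open>fine_term_Suc\<close>.\<close>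
    have "q ^ M = q ^ n * q ^ (M - n)"
      using that by (simp flip: power_add)
    then have w: "w n = (1 - b * q ^ n) * (1 - t * q ^ (M - n)) -
        t * (1 - a * q ^ Suc n) * (1 - q ^ (M - n))"
      unfolding w_def power_Suc by (simp add: algebra_simps)
    show ?thesis
      unfolding w G_def T_def fine_term_Suc[OF assms that]
      by (simp add: algebra_simps del: power_Suc)
  qed
  then have "(\<Sum>n<M. w n * T n) = G 0 - G M"
    by (simp add: sum_lessThan_telescope')
  \<comment> \<open>The top term is treated separately: the recurrence stops at
    \<open>n < M\<close>, and at \<open>n = M\<close> the weight is already
    \<open>(1 - b q^M)(1 - t)\<close>, which cancels the leftover \<open>- G M\<close>.\<close>
  moreover have "w M * T M = G M"
    by (simp add: w_def G_def)
  moreover have "G 0 = (1 - b) * (1 - t * q ^ M)"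
    using fine_term_0[OF assms(1,2)] by (simp add: G_def T_def)
  ultimately show ?thesis
    by (simp add: w_def T_def flip: lessThan_Suc_atMost)
qed

theorem theorem3p2:
  fixes q a b t :: complex and N :: nat
  assumes "norm q < 1"
    and "N > 0"
    and "qpoch t q (N + 1) \<noteq> 0"
    and "qpoch (b * q) q (N + 1) \<noteq> 0"
  shows "fine q (N + 1) a b t =
           (1 - b) * (1 - t * q ^ (N + 1)) / ((1 - t) * (1 - b * q ^ (N + 1))) +
           (1 - q ^ (N + 1)) * (b - a * t * q) / ((1 - b * q ^ (N + 1)) * (1 - t)) *
             fine q N a b (t * q)"
proof -
  define M where "M = Suc N"
  define T where "T = fine_term q M a b t"
  have M: "qpoch t q M \<noteq> 0" "qpoch (b * q) q M \<noteq> 0" "N + 1 = M"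
    using assms by (simp_all add: M_def)
  have nz: "1 - t \<noteq> 0" "1 - b * q ^ M \<noteq> 0"
    \<comment> \<open>The symbol in \<open>b * q\<close> starts at \<open>b q\<close>, so its factor
      of index \<open>N\<close> is \<open>1 - b q^(N+1)\<close>.\<close>
    using qpoch_neq_0_factor[OF M(1), of 0] qpoch_neq_0_factor[OF M(2), of N]
    by (simp_all add: M_def mult.assoc)
  have F: "fine q M a b t = (\<Sum>n\<le>M. T n)"
    using fine_eq_sum_fine_term[OF assms(1)] by (simp add: T_def)
  have "(1 - q ^ M) * fine q N a b (t * q) = (\<Sum>n\<le>N. (q ^ n - q ^ M) * T n)"
    unfolding fine_eq_sum_fine_term[OF assms(1)] sum_distrib_left T_def M_def
    using assms(1) M(1) by (intro sum.cong refl fine_term_shift) (auto simp: M_def)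
  \<comment> \<open>The added term \<open>n = M\<close> has coefficient
    \<open>q ^ M - q ^ M = 0\<close>.\<close>
  also have "\<dots> = (\<Sum>n\<le>M. (q ^ n - q ^ M) * T n)"
    by (simp add: M_def)
  finally have shift: "(1 - q ^ M) * fine q N a b (t * q) = (\<Sum>n\<le>M. (q ^ n - q ^ M) * T n)" .
  \<comment> \<open>By linearity the weighted sum turns into a relation between the two values of
    \<open>fine\<close>, which is then solved for the one of index \<open>M\<close>.\<close>
  have "(\<Sum>n\<le>M. (c - d * (q ^ n - q ^ M)) * T n) =
      c * (\<Sum>n\<le>M. T n) - d * (\<Sum>n\<le>M. (q ^ n - q ^ M) * T n)" for c d
    by (simp only: left_diff_distrib[of c] sum_subtractf sum_distrib_left mult.assoc)
  then have "(1 - b * q ^ M) * (1 - t) * fine q M a b t -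
      (b - a * t * q) * ((1 - q ^ M) * fine q N a b (t * q)) = (1 - b) * (1 - t * q ^ M)"
    using sum_fine_term_weighted[OF assms(1) M(1,2), of a]
    by (simp add: F shift T_def)
  then have "(1 - b * q ^ M) * (1 - t) * fine q M a b t =
      (1 - b) * (1 - t * q ^ M) + (1 - q ^ M) * (b - a * t * q) * fine q N a b (t * q)"
    by (simp add: diff_eq_eq ac_simps)
  then have "fine q M a b t =
      ((1 - b) * (1 - t * q ^ M) + (1 - q ^ M) * (b - a * t * q) * fine q N a b (t * q)) /
      ((1 - b * q ^ M) * (1 - t))"
    using nz by (simp add: nonzero_eq_divide_eq mult.commute)
  then show ?thesis
    unfolding M(3) by (simp add: add_divide_distrib mult.commute[of "1 - t"])
qed

end
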